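(* Consider the mixed-traffic kinematic wave model $$(\rho_1)_t+\big(\rho_1V(\rho_1,\rho_2)\big)_x=0,\qquad (\rho_2)_t+\big(\rho_2V(\rho_1,\rho_2)\big)_x=0 .$$ A left state $\rho^l=(\rho_1^l,\rho_2^l)$ and a right state $\rho^r=(\rho_1^r,\rho_2^r)$ satisfy the jump conditions $$s(\rho_i^l-\rho_i^r)=\rho_i^lV(\rho_1^l,\rho_2^l)-\rho_i^rV(\rho_1^r,\rho_2^r),\qquad i=1,2,$$ for some speed $s\in\mathbb{R}$ if and only if one of the following holds: either $V(\rho_1^l,\rho_2^l)=V(\rho_1^r,\rho_2^r)$ (the two states are connected by a contact wave), or $\rho_1^l\rho_2^r-\rho_1^r\rho_2^l=0$, i.e. the two states lie on a common ray from the origin of the $(\rho_1,\rho_2)$-plane (the candidates for shock waves, across which the vehicle composition does not change).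
   Context: $\rho_1,\rho_2\ge0$ are the densities of two vehicle types (e.g. passenger cars and trucks) and $V(\rho_1,\rho_2)$ is the common group speed, a continuous real-valued function on the set of feasible states (both types are assumed to have the same free-flow speed, which ensures continuity of $V$). States are feasible pairs $(\rho_1,\rho_2)$ with nonnegative entries. *)

theory Defs
  imports "HOL-Analysis.Analysis"
begin

text \<open>A state is the pair of densities \<open>\<rho> = (\<rho>\<^sub>1, \<rho>\<^sub>2)\<close>.\<close>

type_synonym state = "real \<times> real"

text \<open>The flux \<open>F\<close> of the model, read as the system of conservation laws \<open>\<rho>\<^sub>t + F(\<rho>)\<^sub>x = 0\<close>.\<close>

definition flux :: "(state \<Rightarrow> real) \<Rightarrow> state \<Rightarrow> state"
  where "flux V \<rho> = (fst \<rho> * V \<rho>, snd \<rho> * V \<rho>)"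

text \<open>The Rankine--Hugoniot conditions for a jump of speed \<open>s\<close> between
  the left state \<open>l\<close> and the right state \<open>r\<close>.\<close>

definition jump_conditions :: "(state \<Rightarrow> real) \<Rightarrow> real \<Rightarrow> state \<Rightarrow> state \<Rightarrow> bool"
  where "jump_conditions V s l r \<longleftrightarrow>
    s * (fst l - fst r) = fst (flux V l) - fst (flux V r) \<and>
    s * (snd l - snd r) = snd (flux V l) - snd (flux V r)"

text \<open>Rays are closed, so the empty-road state \<open>0\<close> lies on every ray; the direction
  must be nonzero.\<close>

definition on_common_ray :: "state \<Rightarrow> state \<Rightarrow> bool"
  where "on_common_ray l r \<longleftrightarrow>
    (\<exists>u::state. u \<noteq> 0 \<and> l \<in> {t *\<^sub>R u | t. 0 \<le> t} \<and> r \<in> {t *\<^sub>R u | t. 0 \<le> t})"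

text \<open>The vehicle composition: the shares of the two types in the total density. It is
  meaningful for nonnegative states other than \<open>0\<close> only.\<close>

definition composition :: "state \<Rightarrow> real \<times> real"
  where "composition \<rho> = (fst \<rho> / (fst \<rho> + snd \<rho>), snd \<rho> / (fst \<rho> + snd \<rho>))"

end

theory Submission
  imports Defs
begin

text \<open>
  The model advects both densities with one speed, so the flux is the vector \<open>V(\<rho>) \<rho>\<close> and the jump
  conditions say \<open>(s - V(l)) l = (s - V(r)) r\<close>. If \<open>l\<close> and \<open>r\<close> are linearly independent, both
  coefficients vanish and \<open>V(l) = s = V(r)\<close>: a contact wave. If they are dependent, nonnegativity
  places them on a common ray (\<open>det_zero_iff_common_ray\<close>), say \<open>l = a u\<close> and \<open>r = b u\<close>. The two
  conditions then collapse to the single scalar equation \<open>s (a - b) = a V(l) - b V(r)\<close>, the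
  Rankine--Hugoniot condition along the ray. It is solvable for \<open>s\<close> when \<open>a \<noteq> b\<close>; when \<open>a = b\<close> the
  states coincide and so do their speeds (\<open>common_ray_jump\<close>). The composition is homogeneous of
  degree zero, hence constant along a ray with its apex removed.
\<close>

text \<open>
  Subtracting \<open>r\<^sub>1\<close> times the second condition from \<open>r\<^sub>2\<close> times the first eliminates \<open>r\<close> and leaves
  \<open>(s - V(l)) det(l, r) = 0\<close>; eliminating \<open>l\<close> gives the same with \<open>V(r)\<close>.
\<close>

lemma jump_imp_contact_or_det_zero:
  assumes "jump_conditions V s l r"
  shows "V l = V r \<or> fst l * snd r - fst r * snd l = 0"
proof -
  have first: "(s - V l) * fst l = (s - V r) * fst r"
    and second: "(s - V l) * snd l = (s - V r) * snd r"
    using assms by (simp_all add: jump_conditions_def flux_def algebra_simps)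
  have "(s - V l) * (fst l * snd r - fst r * snd l) = 0"
    using first second by algebra
  moreover have "(s - V r) * (fst l * snd r - fst r * snd l) = 0"
    using first second by algebra
  ultimately show ?thesis by auto
qed

lemma contact_jump:
  assumes "V l = V r"
  shows "jump_conditions V (V l) l r"
  using assms by (simp add: jump_conditions_def flux_def algebra_simps)

lemma common_ray_jump:
  assumes "on_common_ray l r"
  shows "\<exists>s. jump_conditions V s l r"
proof -
  obtain u a b where l: "l = a *\<^sub>R u" and r: "r = b *\<^sub>R u"
    using assms unfolding on_common_ray_def by blast
  show ?thesis
  proof (cases "a = b")
    case True
    then have "V l = V r" by (simp add: l r)
    then show ?thesis by (blast intro: contact_jump)
  next
    case False
    define s where "s = (a * V l - b * V r) / (a - b)"
    have speed: "s * (a - b) = a * V l - b * V r"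
      using False by (simp add: s_def)
    have component: "s * (a * c - b * c) = a * c * V l - b * c * V r" for c
      using arg_cong[OF speed, of "\<lambda>x. x * c"] by (simp add: algebra_simps)
    have "jump_conditions V s l r"
      unfolding jump_conditions_def flux_def
      using component[of "fst u"] component[of "snd u"] by (simp add: l r)
    then show ?thesis ..
  qed
qed

text \<open>
  For nonnegative states \<open>l + r\<close> vanishes only if both do, so it serves as direction without singling
  out the cases in which one of the states is the empty road. The coordinates of \<open>l\<close> and \<open>r\<close> along
  it are their shares of the joint total density. Without nonnegativity the equivalence fails:
  opposite vectors are dependent but not on a common ray.
\<close>

lemma det_zero_iff_common_ray:
  fixes l r :: state
  assumes "0 \<le> fst l" "0 \<le> snd l" "0 \<le> fst r" "0 \<le> snd r"
  shows "fst l * snd r - fst r * snd l = 0 \<longleftrightarrow> on_common_ray l r"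
proof
  assume "on_common_ray l r"
  then show "fst l * snd r - fst r * snd l = 0"
    by (auto simp: on_common_ray_def)
next
  assume det: "fst l * snd r - fst r * snd l = 0"
  show "on_common_ray l r"
  proof (cases "l = 0 \<and> r = 0")
    case True
    \<comment> \<open>The apex lies on every ray; any nonzero direction will do.\<close>
    then show ?thesis
      unfolding on_common_ray_def
      by (intro exI[of _ "(1, 1)"]) (auto simp: zero_prod_def intro!: exI[of _ "0 :: real"])
  next
    case False
    define m where "m = (\<lambda>\<rho>::state. fst \<rho> + snd \<rho>)"
    have m_nonneg: "0 \<le> m l" "0 \<le> m r"
      using assms by (simp_all add: m_def)
    have m_pos: "0 < m l + m r"
      using False assms by (auto simp: m_def prod_eq_iff)
    then have "l + r \<noteq> 0"
      by (auto simp: m_def prod_eq_iff)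
    moreover have "l = (m l / (m l + m r)) *\<^sub>R (l + r)"
    proof -
      have "fst l * (m l + m r) = m l * (fst l + fst r)"
           "snd l * (m l + m r) = m l * (snd l + snd r)"
        using det by (simp_all add: m_def algebra_simps)
      with m_pos show ?thesis by (simp add: prod_eq_iff nonzero_eq_divide_eq)
    qed
    moreover have "r = (m r / (m l + m r)) *\<^sub>R (l + r)"
    proof -
      have "fst r * (m l + m r) = m r * (fst l + fst r)"
           "snd r * (m l + m r) = m r * (snd l + snd r)"
        using det by (simp_all add: m_def algebra_simps)
      with m_pos show ?thesis by (simp add: prod_eq_iff nonzero_eq_divide_eq)
    qed
    moreover have "0 \<le> m l / (m l + m r)" "0 \<le> m r / (m l + m r)"
      using m_nonneg by simp_all
    ultimately show ?thesis
      unfolding on_common_ray_def by blast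
  qed
qed

lemma composition_scaleR:
  assumes "t \<noteq> 0"
  shows "composition (t *\<^sub>R u) = composition u"
  using assms by (simp add: composition_def flip: distrib_left)

lemma common_ray_composition:
  assumes "on_common_ray l r" "l \<noteq> 0" "r \<noteq> 0"
  shows "composition l = composition r"
proof -
  obtain u a b where l: "l = a *\<^sub>R u" and r: "r = b *\<^sub>R u"
    using assms(1) unfolding on_common_ray_def by blast
  then have "a \<noteq> 0" "b \<noteq> 0"
    using assms(2,3) by auto
  then show ?thesis
    unfolding l r by (metis composition_scaleR)
qed

theorem mainTheorem4:
  fixes V :: "state \<Rightarrow> real" and D :: "state set" and l r :: state
  assumes feasible: "D \<subseteq> {\<rho>. 0 \<le> fst \<rho> \<and> 0 \<le> snd \<rho>}"
    and cont: "continuous_on D V"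
    and "l \<in> D" and "r \<in> D"
  shows "((\<exists>s. jump_conditions V s l r) \<longleftrightarrow>
          V l = V r \<or> fst l * snd r - fst r * snd l = 0) \<and>
         (fst l * snd r - fst r * snd l = 0 \<longleftrightarrow> on_common_ray l r) \<and>
         (fst l * snd r - fst r * snd l = 0 \<and> l \<noteq> 0 \<and> r \<noteq> 0 \<longrightarrow>
          composition l = composition r)"
proof -
  have ray: "fst l * snd r - fst r * snd l = 0 \<longleftrightarrow> on_common_ray l r"
    using feasible \<open>l \<in> D\<close> \<open>r \<in> D\<close> by (intro det_zero_iff_common_ray) auto
  have "(\<exists>s. jump_conditions V s l r) \<longleftrightarrow>
        V l = V r \<or> fst l * snd r - fst r * snd l = 0"
    using jump_imp_contact_or_det_zero contact_jump common_ray_jump ray by metis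
  with ray show ?thesis
    using common_ray_composition by blast
qed

end
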